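(* Let $I=[0,\infty)$, let $s\in(0,1]$, let $f,g\in SX((h-s)_2,I)$, let $h$ be super-multiplicative, and let $f,g$ be similarly ordered functions on $I$. Let $a,b\in I$ with $a<b$, and put $M(a,b)=f(a)g(a)+f(b)g(b)$. If $f,g,fg\in L_1[a,b]$ and $h\in L_1[0,1]$, then both of the following inequalities hold: $$f\!\left(\frac{a+b}{2}\right)g\!\left(\frac{a+b}{2}\right)\le 2h^s\!\left(\frac14\right)M(a,b)\int_0^1\left(h^s(t)+h^s(1-t)\right)^2dt$$ and $$\frac{1}{2h^{2s}\!\left(\frac12\right)}f\!\left(\frac{a+b}{2}\right)g\!\left(\frac{a+b}{2}\right)\le \frac{1}{b-a}\int_a^b f(x)g(x)\,dx+\frac{M(a,b)}{2}\left(\int_0^1\left(h^s(t)+h^s(1-t)\right)^2dt\right).$$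
   Context: Notation: $h^s(t)=(h(t))^s$ and $h^{2s}(t)=(h(t))^{2s}$. Definition of $SX((h-s)_2,I)$: let $h:J\subset\mathbb{R}\to\mathbb{R}$ be a non-negative function, $h\neq 0$, defined at all points of $[0,1]$ (where it is evaluated), and let $s\in(0,1]$. A function $f:I=[0,\infty)\to\mathbb{R}$ is $(h-s)_2$-convex (in the second sense), written $f\in SX((h-s)_2,I)$, if $f$ is non-negative and for all $u,v\in I$ and $t\in[0,1]$, $$f(tu+(1-t)v)\le h^s(t)f(u)+h^s(1-t)f(v).$$ A function $h:J\to\mathbb{R}$ is super-multiplicative if $h(xy)\ge h(x)h(y)$ for all $x,y\in J$. Functions $f,g:X\to\mathbb{R}$ are similarly ordered if $(f(x)-f(y))(g(x)-g(y))\ge 0$ for every $x,y\in X$. *)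

theory Defs
  imports "HOL-Analysis.Analysis"
begin

text \<open>
  The class \<open>SX((h-s)\<^sub>2, I)\<close>. Functions are total in HOL; only the values of \<open>f\<close> on \<open>I\<close> and of
  \<open>h\<close> on \<open>[0,1]\<close> are constrained. The power \<open>powr\<close> agrees with the usual one, also at base \<open>0\<close>,
  because it is only used with nonnegative \<open>h\<close> and \<open>s > 0\<close> (\<open>0 powr s = 0\<close>).
\<close>

definition SX2 :: "(real \<Rightarrow> real) \<Rightarrow> real \<Rightarrow> real set \<Rightarrow> (real \<Rightarrow> real) set" where
  "SX2 h s I = {f. (\<forall>u\<in>I. 0 \<le> f u) \<and>
     (\<forall>u\<in>I. \<forall>v\<in>I. \<forall>t\<in>{0..1}.
        f (t * u + (1 - t) * v) \<le> h t powr s * f u + h (1 - t) powr s * f v)}"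

text \<open>
  The domain \<open>J\<close> need not be closed under multiplication, so the inequality is required exactly
  where its left-hand side is defined.
\<close>

definition super_multiplicative_on :: "real set \<Rightarrow> (real \<Rightarrow> real) \<Rightarrow> bool" where
  "super_multiplicative_on J h \<longleftrightarrow>
     (\<forall>x\<in>J. \<forall>y\<in>J. x * y \<in> J \<longrightarrow> h x * h y \<le> h (x * y))"

definition similarly_ordered_on :: "'a set \<Rightarrow> ('a \<Rightarrow> real) \<Rightarrow> ('a \<Rightarrow> real) \<Rightarrow> bool" where
  "similarly_ordered_on X f g \<longleftrightarrow> (\<forall>x\<in>X. \<forall>y\<in>X. 0 \<le> (f x - f y) * (g x - g y))"

text \<open>
  The integral of \<open>(h\<^sup>s(t) + h\<^sup>s(1-t))\<^sup>2\<close> over \<open>[0,1]\<close>, with values in \<open>[0,\<infinity>]\<close>: integrability of \<open>h\<close>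
  does not make it finite (take \<open>s = 1\<close>, \<open>h 0 = 0\<close> and \<open>h t = t powr (-1/2)\<close> for \<open>t > 0\<close>), and the
  Bochner integral would then be \<open>0\<close> instead of \<open>\<infinity>\<close>. Inequalities
  involving it are stated in \<^typ>\<open>ennreal\<close>; the real quantities embedded there must be nonnegative,
  which holds for \<open>f, g \<in> SX2 h s {0..}\<close> and \<open>h \<ge> 0\<close>.
\<close>

definition hs_sq_integral :: "(real \<Rightarrow> real) \<Rightarrow> real \<Rightarrow> ennreal" where
  "hs_sq_integral h s =
     (\<integral>\<^sup>+ t \<in> {0..1}. ennreal ((h t powr s + h (1 - t) powr s)\<^sup>2) \<partial>lebesgue)"

end

theory Submission
  imports Defs
begin

text \<open>
  For \<open>x = t a + (1 - t) b\<close> and \<open>y = (1 - t) a + t b\<close> the midpoint of \<open>a, b\<close> is also the midpoint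
  of \<open>x, y\<close>. Convexity at \<open>1/2\<close> bounds \<open>f g\<close> at the midpoint by
  \<open>h\<^sup>s(1/2)\<^sup>2 (f x + f y) (g x + g y)\<close>. Convexity at \<open>t\<close> and similar ordering bound the mixed
  terms \<open>f x g y + f y g x\<close> by \<open>(h\<^sup>s(t) + h\<^sup>s(1 - t))\<^sup>2 M(a,b)\<close>, and the whole product by twice
  that. Integrating over \<open>t\<close> gives both inequalities, the first one together with
  \<open>h(1/2)\<^sup>2 \<le> h(1/4)\<close>.
\<close>

section \<open>Elementary consequences of convexity and similar ordering\<close>

lemma SX2_nonneg: "f \<in> SX2 h s I \<Longrightarrow> u \<in> I \<Longrightarrow> 0 \<le> f u"
  by (simp add: SX2_def)

lemma SX2_ineq:
  "f \<in> SX2 h s I \<Longrightarrow> u \<in> I \<Longrightarrow> v \<in> I \<Longrightarrow> 0 \<le> t \<Longrightarrow> t \<le> 1 \<Longrightarrow>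
    f (t * u + (1 - t) * v) \<le> h t powr s * f u + h (1 - t) powr s * f v"
  by (simp add: SX2_def)

lemma SX2_midpoint:
  assumes "f \<in> SX2 h s I" "x \<in> I" "y \<in> I"
  shows "f ((x + y) / 2) \<le> h (1 / 2) powr s * (f x + f y)"
  using SX2_ineq[OF assms, of "1 / 2"] by (simp add: field_simps)

text \<open>Expanding \<open>0 \<le> (f a - f b) * (g a - g b)\<close> separates the mixed products
  from those at a single point.\<close>

lemma similarly_ordered_onD:
  "similarly_ordered_on X f g \<Longrightarrow> a \<in> X \<Longrightarrow> b \<in> X \<Longrightarrow> f a * g b + f b * g a \<le> f a * g a + f b * g b"
  unfolding similarly_ordered_on_def by (force simp: algebra_simps)

section \<open>Pointwise bounds at a fixed parameter \<open>t\<close>\<close>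

context
  fixes h f g :: "real \<Rightarrow> real" and s a b t :: real
  assumes f: "f \<in> SX2 h s {0..}" and g: "g \<in> SX2 h s {0..}"
    and ord: "similarly_ordered_on {0..} f g"
    and a: "0 \<le> a" and b: "0 \<le> b" and t: "0 \<le> t" "t \<le> 1"
begin

lemma segment_points_nonneg: "0 \<le> t * a + (1 - t) * b" "0 \<le> t * b + (1 - t) * a"
  using a b t by simp_all

lemma endpoint_values_nonneg: "0 \<le> f a" "0 \<le> f b" "0 \<le> g a" "0 \<le> g b"
  using f g a b by (auto intro: SX2_nonneg)

lemma SX2_reflected_le:
  assumes "k \<in> SX2 h s {0..}"
  shows "k (t * a + (1 - t) * b) \<le> h t powr s * k a + h (1 - t) powr s * k b"
    and "k (t * b + (1 - t) * a) \<le> h t powr s * k b + h (1 - t) powr s * k a"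
  using a b t by (auto intro!: SX2_ineq[OF assms])

text \<open>The two reflected points sum to \<open>a + b\<close> for every \<open>t\<close>, so the
  left side is constant in \<open>t\<close> and the bound can be averaged over
  \<open>t\<close>.\<close>

lemma midpoint_product_le:
  "f ((a + b) / 2) * g ((a + b) / 2) \<le> (h (1 / 2) powr s)\<^sup>2 *
     ((f (t * a + (1 - t) * b) + f (t * b + (1 - t) * a)) *
      (g (t * a + (1 - t) * b) + g (t * b + (1 - t) * a)))"
proof -
  have mid: "((t * a + (1 - t) * b) + (t * b + (1 - t) * a)) / 2 = (a + b) / 2"
    by (simp add: algebra_simps)
  have le: "k ((a + b) / 2) \<le> h (1 / 2) powr s *
      (k (t * a + (1 - t) * b) + k (t * b + (1 - t) * a))" if "k \<in> SX2 h s {0..}" for k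
    using SX2_midpoint[OF that, of "t * a + (1 - t) * b" "t * b + (1 - t) * a"]
      segment_points_nonneg unfolding mid by simp
  have "f ((a + b) / 2) * g ((a + b) / 2) \<le>
     (h (1 / 2) powr s * (f (t * a + (1 - t) * b) + f (t * b + (1 - t) * a))) *
     (h (1 / 2) powr s * (g (t * a + (1 - t) * b) + g (t * b + (1 - t) * a)))"
    using a b segment_points_nonneg
    by (intro mult_mono le f g mult_nonneg_nonneg add_nonneg_nonneg
        SX2_nonneg[OF f] SX2_nonneg[OF g]) auto
  then show ?thesis
    by (simp add: power2_eq_square mult_ac)
qed

text \<open>Multiplying out the bounds at the reflected points puts weight \<open>2 * p * q\<close>
  on the products at one endpoint and \<open>p\<^sup>2 + q\<^sup>2\<close> on the mixed ones.
  Similar ordering replaces the latter by the former, and the weights add up to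
  \<open>(p + q)\<^sup>2\<close>.\<close>

lemma mixed_products_le:
  "f (t * a + (1 - t) * b) * g (t * b + (1 - t) * a) + f (t * b + (1 - t) * a) * g (t * a + (1 - t) * b)
    \<le> (h t powr s + h (1 - t) powr s)\<^sup>2 * (f a * g a + f b * g b)"
proof -
  define p q where "p = h t powr s" and "q = h (1 - t) powr s"
  note le = SX2_reflected_le[folded p_def q_def]
  note nn = endpoint_values_nonneg
  have pq: "0 \<le> p" "0 \<le> q"
    by (simp_all add: p_def q_def)
  have "f (t * a + (1 - t) * b) * g (t * b + (1 - t) * a) + f (t * b + (1 - t) * a) * g (t * a + (1 - t) * b)
     \<le> (p * f a + q * f b) * (p * g b + q * g a) + (p * f b + q * f a) * (p * g a + q * g b)"
    using nn pq segment_points_nonneg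
    by (intro add_mono mult_mono le f g mult_nonneg_nonneg add_nonneg_nonneg SX2_nonneg[OF g]) auto
  also have "\<dots> = 2 * p * q * (f a * g a + f b * g b) + (p\<^sup>2 + q\<^sup>2) * (f a * g b + f b * g a)"
    by (simp add: algebra_simps power2_eq_square)
  also have "\<dots> \<le> 2 * p * q * (f a * g a + f b * g b) + (p\<^sup>2 + q\<^sup>2) * (f a * g a + f b * g b)"
    using a b by (intro add_left_mono mult_left_mono similarly_ordered_onD[OF ord]) auto
  also have "\<dots> = (p + q)\<^sup>2 * (f a * g a + f b * g b)"
    by (simp add: algebra_simps power2_eq_square)
  finally show ?thesis
    by (simp add: p_def q_def)
qed

text \<open>Adding the two reflected bounds gives both endpoints the same weight \<open>w\<close>.
  The factor 2 appears because similar ordering bounds the mixed endpoint products by a second copy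
  of the unmixed ones.\<close>

lemma sum_products_le:
  "(f (t * a + (1 - t) * b) + f (t * b + (1 - t) * a)) *
   (g (t * a + (1 - t) * b) + g (t * b + (1 - t) * a))
    \<le> 2 * (h t powr s + h (1 - t) powr s)\<^sup>2 * (f a * g a + f b * g b)"
proof -
  define w where "w = h t powr s + h (1 - t) powr s"
  have w: "0 \<le> w"
    by (simp add: w_def)
  note nn = endpoint_values_nonneg
  have le: "k (t * a + (1 - t) * b) + k (t * b + (1 - t) * a) \<le> w * (k a + k b)"
    if "k \<in> SX2 h s {0..}" for k
    using SX2_reflected_le[OF that] by (simp add: w_def algebra_simps)
  have "(f (t * a + (1 - t) * b) + f (t * b + (1 - t) * a)) *
      (g (t * a + (1 - t) * b) + g (t * b + (1 - t) * a)) \<le> (w * (f a + f b)) * (w * (g a + g b))"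
    using nn w segment_points_nonneg
    by (intro mult_mono le f g mult_nonneg_nonneg add_nonneg_nonneg SX2_nonneg[OF g]) auto
  also have "\<dots> = w\<^sup>2 * ((f a * g a + f b * g b) + (f a * g b + f b * g a))"
    by (simp add: algebra_simps power2_eq_square)
  also have "\<dots> \<le> w\<^sup>2 * ((f a * g a + f b * g b) + (f a * g a + f b * g b))"
    using a b by (intro mult_left_mono add_left_mono similarly_ordered_onD[OF ord]) auto
  also have "\<dots> = 2 * w\<^sup>2 * (f a * g a + f b * g b)"
    by simp
  finally show ?thesis
    by (simp add: w_def)
qed

end

section \<open>Affine substitution and Lebesgue measurability\<close>

text \<open>Substitution \<open>x = b + (a - b) * t\<close> over the whole line. The absolute value
  covers both orientations, so that the reflected path is the case with \<open>a\<close> and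
  \<open>b\<close> exchanged.\<close>

lemma nn_integral_segment:
  fixes F :: "real \<Rightarrow> ennreal" and a b :: real
  assumes "F \<in> borel_measurable lebesgue" and "a \<noteq> b"
  shows "(\<integral>\<^sup>+ t. F (t * a + (1 - t) * b) \<partial>lebesgue) = ennreal (1 / \<bar>a - b\<bar>) * (\<integral>\<^sup>+ x. F x \<partial>lebesgue)"
proof -
  have "ennreal (1 / \<bar>a - b\<bar>) * (\<integral>\<^sup>+ x. F x \<partial>lebesgue)
      = ennreal (1 / \<bar>a - b\<bar>) * (ennreal \<bar>a - b\<bar> * (\<integral>\<^sup>+ t. F (b + (a - b) * t) \<partial>lebesgue))"
    using assms by (subst nn_integral_real_affine_lebesgue[of F "a - b" b]) auto
  also have "\<dots> = (\<integral>\<^sup>+ t. F (b + (a - b) * t) \<partial>lebesgue)"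
    using \<open>a \<noteq> b\<close> by (simp add: mult.assoc[symmetric] ennreal_mult[symmetric])
  finally show ?thesis
    by (simp add: algebra_simps)
qed

text \<open>Composition with a Lebesgue measurable function is safe here because a nonconstant
  affine map pulls null sets back to null sets; hence \<open>a \<noteq> b\<close>.\<close>

lemma measurable_segment:
  fixes F :: "real \<Rightarrow> 'a :: topological_space" and a b :: real
  assumes "F \<in> borel_measurable lebesgue" and "a \<noteq> b"
  shows "(\<lambda>t. F (t * a + (1 - t) * b)) \<in> borel_measurable lebesgue"
proof -
  have "(\<lambda>t. b + (a - b) * t) \<in> lebesgue \<rightarrow>\<^sub>M lebesgue"
    using lebesgue_affine_measurable[of "\<lambda>_. a - b" b] \<open>a \<noteq> b\<close> by simp
  from measurable_compose[OF this assms(1)] show ?thesis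
    by (simp add: algebra_simps)
qed

text \<open>Measurability of \<open>h\<close> is known only on \<open>[0,1]\<close>, so
  \<open>h\<close> is replaced by its extension by zero. As \<open>1 - t\<close> maps
  \<open>[0,1]\<close> to itself, the extension and its reflection give the same integrand
  there.\<close>

lemma measurable_hs_sq:
  fixes h :: "real \<Rightarrow> real"
  assumes "set_borel_measurable lebesgue {0..1} h"
  shows "(\<lambda>t. ennreal ((h t powr s + h (1 - t) powr s)\<^sup>2) * indicator {0..1} t)
    \<in> borel_measurable lebesgue"
proof -
  define k where "k t = indicator {0..1} t *\<^sub>R h t" for t
  have k [measurable]: "k \<in> borel_measurable lebesgue"
    using assms by (simp add: set_borel_measurable_def k_def[abs_def])
  define r where "r t = k (1 - t)" for t
  have [measurable]: "r \<in> borel_measurable lebesgue"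
    using measurable_segment[OF k, of 0 1] by (simp add: r_def[abs_def])
  have [measurable]: "{0..1::real} \<in> sets lebesgue"
    by simp
  have "(\<lambda>t. ennreal ((k t powr s + r t powr s)\<^sup>2) * indicator {0..1} t)
    \<in> borel_measurable lebesgue"
    by measurable
  also have "(\<lambda>t. ennreal ((k t powr s + r t powr s)\<^sup>2) * indicator {0..1} t) =
      (\<lambda>t. ennreal ((h t powr s + h (1 - t) powr s)\<^sup>2) * indicator {0..1} t)"
    by (auto simp: k_def r_def fun_eq_iff indicator_def)
  finally show ?thesis .
qed

lemma ennreal_linear_combination:
  assumes "0 \<le> c" "0 \<le> d" "0 \<le> e" "0 \<le> x" "0 \<le> y" "0 \<le> z"
  shows "ennreal (c * x + d * y + e * z) =
    ennreal c * ennreal x + ennreal d * ennreal y + ennreal e * ennreal z"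
  using assms by (simp add: ennreal_mult)

lemma ennreal_half_add_half:
  assumes "0 \<le> x"
  shows "ennreal (1 / 2) * ennreal x + ennreal (1 / 2) * ennreal x = ennreal x"
  using ennreal_linear_combination[of "1 / 2" "1 / 2" 0 x x 0] assms by simp

lemma nn_integral_const_unit_interval:
  "(\<integral>\<^sup>+ t \<in> {0..1::real}. c \<partial>lebesgue) = c"
  by (simp add: nn_integral_cmult_indicator)

section \<open>Integration of the pointwise bounds over \<open>[0,1]\<close>\<close>

theorem theorem7:
  fixes J :: "real set" and h f g :: "real \<Rightarrow> real" and s a b :: real
  assumes "{0..1} \<subseteq> J"
    and "\<forall>t\<in>J. 0 \<le> h t"
    and "\<exists>t\<in>J. h t \<noteq> 0"
    and "0 < s" and "s \<le> 1"
    and "f \<in> SX2 h s {0..}" and "g \<in> SX2 h s {0..}"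
    and "super_multiplicative_on J h"
    and "similarly_ordered_on {0..} f g"
    and "a \<in> {0..}" and "b \<in> {0..}" and "a < b"
    and "f absolutely_integrable_on {a..b}"
    and "g absolutely_integrable_on {a..b}"
    and "(\<lambda>x. f x * g x) absolutely_integrable_on {a..b}"
    and "h absolutely_integrable_on {0..1}"
  shows "ennreal (f ((a + b) / 2) * g ((a + b) / 2))
           \<le> ennreal (2 * h (1 / 4) powr s * (f a * g a + f b * g b)) * hs_sq_integral h s
       \<and> ennreal (1 / (2 * h (1 / 2) powr (2 * s)) * (f ((a + b) / 2) * g ((a + b) / 2)))
           \<le> ennreal (1 / (b - a) * (LINT x:{a..b}|lebesgue. f x * g x))
             + ennreal ((f a * g a + f b * g b) / 2) * hs_sq_integral h s"
proof -
  have a: "0 \<le> a" and b: "0 \<le> b"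
    using assms by auto
  note f = \<open>f \<in> _\<close> and g = \<open>g \<in> _\<close> and ord = \<open>similarly_ordered_on _ _ _\<close>
  define M where "M = f a * g a + f b * g b"
  define m where "m = f ((a + b) / 2) * g ((a + b) / 2)"
  define W where "W t = (h t powr s + h (1 - t) powr s)\<^sup>2" for t
  define H where "H = (h (1 / 2) powr s)\<^sup>2"
  have fg_nonneg: "0 \<le> f x * g x" if "0 \<le> x" for x
    using that by (auto intro!: mult_nonneg_nonneg SX2_nonneg[OF f] SX2_nonneg[OF g])
  have M: "0 \<le> M" and m: "0 \<le> m"
    using fg_nonneg a b by (auto simp: M_def m_def)
  have W: "0 \<le> W t" for t
    by (simp add: W_def)
  have H_le: "H \<le> h (1 / 4) powr s"
  proof -
    \<comment> \<open>Super-multiplicativity is applied to \<open>1/4 = 1/2 * 1/2\<close>, which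
      requires the product to lie in \<open>J\<close> as well.\<close>
    have J: "1 / 2 \<in> J" "1 / 4 \<in> J"
      using \<open>{0..1} \<subseteq> J\<close> by auto
    then have "h (1 / 2) * h (1 / 2) \<le> h (1 / 4)" "0 \<le> h (1 / 2)"
      using \<open>super_multiplicative_on J h\<close> \<open>\<forall>t\<in>J. 0 \<le> h t\<close>
      unfolding super_multiplicative_on_def by force+
    then have "(h (1 / 2) * h (1 / 2)) powr s \<le> h (1 / 4) powr s"
      using \<open>0 < s\<close> by (intro powr_mono2) auto
    then show ?thesis
      using \<open>0 \<le> h (1 / 2)\<close> by (simp add: H_def power2_eq_square powr_mult)
  qed
  have hs: "hs_sq_integral h s = (\<integral>\<^sup>+ t. ennreal (W t) * indicator {0..1} t \<partial>lebesgue)"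
    by (simp add: hs_sq_integral_def W_def)
  have W_meas [measurable]: "(\<lambda>t. ennreal (W t) * indicator {0..1} t) \<in> borel_measurable lebesgue"
    unfolding W_def using \<open>h absolutely_integrable_on {0..1}\<close>
    by (intro measurable_hs_sq) (auto simp: absolutely_integrable_measurable
        set_borel_measurable_def set_integrable_def)

  have first: "ennreal m \<le> ennreal (2 * h (1 / 4) powr s * M) * hs_sq_integral h s"
  proof -
    have pointwise: "m \<le> 2 * h (1 / 4) powr s * M * W t" if t: "0 \<le> t" "t \<le> 1" for t
    proof -
      have "m \<le> H * ((f (t * a + (1 - t) * b) + f (t * b + (1 - t) * a)) *
          (g (t * a + (1 - t) * b) + g (t * b + (1 - t) * a)))"
        using midpoint_product_le[OF f g ord a b t] by (simp add: m_def H_def)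
      also have "\<dots> \<le> H * (2 * W t * M)"
        using sum_products_le[OF f g ord a b t]
        by (intro mult_left_mono) (auto simp: H_def W_def M_def)
      also have "\<dots> \<le> h (1 / 4) powr s * (2 * W t * M)"
        using H_le W M by (intro mult_right_mono) auto
      finally show ?thesis
        by (simp add: mult_ac)
    qed
    \<comment> \<open>The constant \<open>m\<close> is its own mean over \<open>[0,1]\<close>.
      Working in \<open>ennreal\<close> allows the integral of \<open>W\<close> to be
      infinite.\<close>
    have "ennreal m = (\<integral>\<^sup>+ t. ennreal m * indicator {0..1::real} t \<partial>lebesgue)"
      by (simp add: nn_integral_const_unit_interval)
    also have "\<dots> \<le> (\<integral>\<^sup>+ t. ennreal (2 * h (1 / 4) powr s * M) *
        (ennreal (W t) * indicator {0..1} t) \<partial>lebesgue)"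
      using pointwise M W
      by (intro nn_integral_mono) (auto simp: indicator_def ennreal_mult[symmetric])
    finally show ?thesis
      by (simp add: nn_integral_cmult hs)
  qed

  have second: "ennreal (1 / (2 * H) * m) \<le> ennreal (1 / (b - a) * (LINT x:{a..b}|lebesgue. f x * g x))
      + ennreal (M / 2) * hs_sq_integral h s"
  proof -
    let ?L = "LINT x:{a..b}|lebesgue. f x * g x"
    \<comment> \<open>Extending \<open>f x * g x\<close> by zero outside \<open>[a,b]\<close> makes
      the substitution on the whole line applicable.\<close>
    define F where "F x = ennreal (indicator {a..b} x *\<^sub>R (f x * g x))" for x
    have int: "integrable lebesgue (\<lambda>x. indicator {a..b} x *\<^sub>R (f x * g x))"
      using assms(15) by (simp add: set_integrable_def)
    then have F_meas [measurable]: "F \<in> borel_measurable lebesgue"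
      unfolding F_def by measurable
    have F_integral: "(\<integral>\<^sup>+ x. F x \<partial>lebesgue) = ennreal ?L"
      unfolding F_def set_lebesgue_integral_def
      using a fg_nonneg by (intro nn_integral_eq_integral int) (auto simp: indicator_def)
    have L: "0 \<le> ?L"
      unfolding set_lebesgue_integral_def
      using a fg_nonneg by (intro integral_nonneg_AE) (auto simp: indicator_def)
    note seg = nn_integral_segment[OF F_meas, of a b] nn_integral_segment[OF F_meas, of b a]
    have [measurable]: "(\<lambda>t. F (t * a + (1 - t) * b)) \<in> borel_measurable lebesgue"
      "(\<lambda>t. F (t * b + (1 - t) * a)) \<in> borel_measurable lebesgue"
      using \<open>a < b\<close> by (auto intro!: measurable_segment)
    have pointwise: "ennreal (1 / (2 * H) * m) \<le> ennreal (1 / 2) * F (t * a + (1 - t) * b)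
        + ennreal (1 / 2) * F (t * b + (1 - t) * a) + ennreal (M / 2) * ennreal (W t)"
      if t: "0 \<le> t" "t \<le> 1" for t
    proof -
      define x y where "x = t * a + (1 - t) * b" and "y = t * b + (1 - t) * a"
      \<comment> \<open>Both points must lie in \<open>[a,b]\<close>, where \<open>F\<close> agrees
        with the product of \<open>f\<close> and \<open>g\<close>.\<close>
      have "t * a \<le> t * b" "(1 - t) * a \<le> (1 - t) * b"
        using t \<open>a < b\<close> by (auto intro: mult_left_mono)
      then have xy: "x \<in> {a..b}" "y \<in> {a..b}"
        by (auto simp: x_def y_def algebra_simps)
      then have nn: "0 \<le> f x * g x" "0 \<le> f y * g y"
        using a fg_nonneg by auto
      have "m \<le> H * ((f x + f y) * (g x + g y))"
        using midpoint_product_le[OF f g ord a b t] by (simp add: m_def H_def x_def y_def)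
      also have "\<dots> = H * (f x * g x + f y * g y + (f x * g y + f y * g x))"
        by (simp add: algebra_simps)
      also have "\<dots> \<le> H * (f x * g x + f y * g y + W t * M)"
        using mixed_products_le[OF f g ord a b t]
        by (intro mult_left_mono add_left_mono) (auto simp: H_def x_def y_def W_def M_def)
      finally have le: "m \<le> H * (f x * g x + f y * g y + W t * M)" .
      have "1 / (2 * H) * m \<le> 1 / 2 * (f x * g x) + 1 / 2 * (f y * g y) + M / 2 * W t"
      \<comment> \<open>Division by zero yields 0, so for \<open>H = 0\<close> the left side
        vanishes and nonnegativity of the right side suffices.\<close>
      proof (cases "H = 0")
        case True
        then show ?thesis
          using nn M W[of t] by simp
      next
        case False
        then have "0 < H"
          by (simp add: H_def)
        then show ?thesis
          using le by (simp add: field_simps)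
      qed
      then have "ennreal (1 / (2 * H) * m)
          \<le> ennreal (1 / 2 * (f x * g x) + 1 / 2 * (f y * g y) + M / 2 * W t)"
        by (rule ennreal_leI)
      also have "\<dots> = ennreal (1 / 2) * F x + ennreal (1 / 2) * F y + ennreal (M / 2) * ennreal (W t)"
        using nn M W[of t] xy ennreal_linear_combination[of "1 / 2" "1 / 2" "M / 2"]
        by (simp add: F_def)
      finally show ?thesis
        by (simp add: x_def y_def)
    qed
    have "ennreal (1 / (2 * H) * m) = (\<integral>\<^sup>+ t. ennreal (1 / (2 * H) * m) * indicator {0..1::real} t \<partial>lebesgue)"
      by (simp add: nn_integral_const_unit_interval)
    \<comment> \<open>The \<open>F\<close> terms need no indicator: for \<open>t\<close> outside
      \<open>[0,1]\<close> both points leave \<open>[a,b]\<close> and \<open>F\<close> is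
      zero.\<close>
    also have "\<dots> \<le> (\<integral>\<^sup>+ t. ennreal (1 / 2) * F (t * a + (1 - t) * b)
        + ennreal (1 / 2) * F (t * b + (1 - t) * a)
        + ennreal (M / 2) * (ennreal (W t) * indicator {0..1} t) \<partial>lebesgue)"
      using pointwise by (intro nn_integral_mono) (auto simp: indicator_def)
    \<comment> \<open>The path and its reflection each contribute half of the mean of
      \<open>f x * g x\<close> over \<open>[a,b]\<close>.\<close>
    also have "\<dots> = ennreal (1 / 2) * (ennreal (1 / (b - a)) * ennreal ?L)
        + ennreal (1 / 2) * (ennreal (1 / (b - a)) * ennreal ?L)
        + ennreal (M / 2) * hs_sq_integral h s"
      using \<open>a < b\<close> by (simp add: nn_integral_add nn_integral_cmult seg F_integral hs)
    also have "ennreal (1 / 2) * (ennreal (1 / (b - a)) * ennreal ?L)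
        + ennreal (1 / 2) * (ennreal (1 / (b - a)) * ennreal ?L) = ennreal (1 / (b - a) * ?L)"
      using \<open>a < b\<close> L
      by (subst (1 2) ennreal_mult[symmetric]) (use ennreal_half_add_half[of "1 / (b - a) * ?L"] \<open>a < b\<close> L in simp_all)
    finally show ?thesis .
  qed
  have "h (1 / 2) powr (2 * s) = H"
    by (simp add: H_def power2_eq_square powr_add[symmetric])
  then show ?thesis
    using first second by (simp add: m_def M_def)
qed

end
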